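(* Let $p$ be an odd prime, $1\le m<n$, $\bar B\subseteq[n]\setminus[m]$ with $|\bar B|=b\ge1$. Let $I$ be the unsaturated generalized order ideal of $\mathbb{GH}(m,n)$ in which every element of $[m]\cup\bar B$ has multiplicity $p-1$ and all other elements have multiplicity $0$, and let $D=\mathbb{F}_p^n\setminus I(\mathbb{GP})$ (unsaturated notion). Write $u=(v,w)$ with $v\in\mathbb{F}_p^m$, $w\in\mathbb{F}_p^{n-m}$, $k=\mathrm{wt}(v)$, and $\delta=1$ if the restriction of $w$ to the coordinates in $\bar B$ is zero, $\delta=0$ otherwise. Put $c_1=p^{n-m-b}$, $c_0=p^{n-m}-p^{n-m-b}$ and $T_k=(-1)^k(p-1)^{m-k}$. If $(m,b)\ne(1,n-1)$, then $|D|=p^n-p^m-(p-1)^m(p^b-1)$, $\dim\mathcal{C}_D=n$, and for every $u\neq0$ \[ \mathrm{wt}(c_D(u))=\frac{p-1}{p}\Big(|D|+p^m[k=0]+T_k(p^b\delta-1)\Big), \] where the number of nonzero $u$ with given $(k,\delta)$ is $\binom mk(p-1)^kc_\delta$, minus one for $(k,\delta)=(0,1)$. The code has at most $2(m+1)$ nonzero weights. For $m=1$ and $b\le n-2$ it is a three-weight code of length $p^n-(p-1)p^b-1$ with weights $(p-1)p^{n-1}-(p-1)^2p^{b-1}$, $(p-1)(p^{n-1}-p^b)$, $(p-1)p^{n-1}$. In the excluded case $(m,b)=(1,n-1)$ one has $D=\{0\}\times(\mathbb{F}_p^{n-1}\setminus0)$, the map $u\mapsto c_D(u)$ has kernel $\mathbb{F}_pe_1$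 (with $e_1$ the first standard basis vector), and $\mathcal{C}_D$ is a one-weight $[p^{n-1}-1,\ n-1,\ (p-1)p^{n-2}]$ code.
   Context: $[n]=\{1,\dots,n\}$; $[\,\cdot\,]$ applied to a condition is $1$ if it holds and $0$ otherwise; $\mathrm{wt}$ is Hamming weight. For $D\subseteq\mathbb{F}_p^n$, $\mathcal{C}_D=\{c_D(u)=(u\cdot x)_{x\in D}:u\in\mathbb{F}_p^n\}$, where $u\cdot x=\sum_i u_ix_i$. An $[N,k,d]$ code is a linear code over $\mathbb{F}_p$ of length $N$, dimension $k$, minimum distance $d$; an $s$-weight code has exactly $s$ distinct nonzero weights. Generalized order ideals: $[n]_{p-1}$ is the multiset in which each $i\in[n]$ has multiplicity $p-1$. A sub-multiset $J$ is identified with its multiplicity vector $(J_1,\dots,J_n)\in\{0,\dots,p-1\}^n=\mathbb{F}_p^n$; $J\subseteq J'$ means $J_i\le J'_i$ (as integers) for all $i$; $\bar J=\{i:J_i\ne0\}$. The hierarchical poset $\mathbb{H}(m,n)$ on $[n]$ has as its only strict relations $i\prec j$ for all $i\in[m]$, $j\in[n]\setminus[m]$; $\mathbb{GH}(m,n)$ denotes $[n]_{p-1}$ together with this order. $J$ is an unsaturated generalized order ideal if $\bar J$ is an order ideal (down-closed subset) of $\mathbb{H}(m,n)$. For an unsaturated generalized order ideal $I$, $I(\mathbb{GP})\subseteq\mathbb{F}_p^n$ is the set of all unsaturated generalized order ideals contained in $I$. *)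

theory Defs
  imports "Berlekamp_Zassenhaus.Finite_Field" "HOL-Library.Multiset" "HOL-Library.Function_Algebras"
begin

text \<open>
  A family of scalars indexed by a set \<open>X\<close> is encoded as a function that vanishes outside \<open>X\<close>.
  Thus \<open>coord_space {1..n}\<close> over \<open>'p mod_ring\<close> is the space of vectors of length \<open>n\<close> over the
  prime field with \<open>CARD('p)\<close> elements, and \<open>coord_space D\<close> is the ambient space of a code whose
  coordinate positions are the elements of \<open>D\<close>.  Addition and zero are the pointwise ones.
\<close>

definition coord_space :: "'i set \<Rightarrow> ('i \<Rightarrow> 'a::zero) set" where
  "coord_space X = {f. \<forall>i. i \<notin> X \<longrightarrow> f i = 0}"

definition coord_scale :: "'a::field \<Rightarrow> ('i \<Rightarrow> 'a) \<Rightarrow> ('i \<Rightarrow> 'a)" where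
  "coord_scale a f = (\<lambda>i. a * f i)"

interpretation coord: vector_space "coord_scale :: 'a::field \<Rightarrow> ('i \<Rightarrow> 'a) \<Rightarrow> ('i \<Rightarrow> 'a)"
  by unfold_locales (auto simp: coord_scale_def algebra_simps fun_eq_iff)

text \<open>
  Only the coordinates in \<open>X\<close> are counted, so \<open>wt X f\<close> is also the weight of the restriction
  of \<open>f\<close> to \<open>X\<close>.
\<close>

definition wt :: "'i set \<Rightarrow> ('i \<Rightarrow> 'a::zero) \<Rightarrow> nat" where
  "wt X f = card {i \<in> X. f i \<noteq> 0}"

definition hamming_dist :: "'i set \<Rightarrow> ('i \<Rightarrow> 'a) \<Rightarrow> ('i \<Rightarrow> 'a) \<Rightarrow> nat" where
  "hamming_dist X f g = card {i \<in> X. f i \<noteq> g i}"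

definition linear_code :: "'i set \<Rightarrow> ('i \<Rightarrow> 'a::field) set \<Rightarrow> bool" where
  "linear_code X C \<longleftrightarrow> finite X \<and> C \<subseteq> coord_space X \<and> coord.subspace C"

definition min_distance :: "'i set \<Rightarrow> ('i \<Rightarrow> 'a) set \<Rightarrow> nat" where
  "min_distance X C = Inf {hamming_dist X f g | f g. f \<in> C \<and> g \<in> C \<and> f \<noteq> g}"

definition nonzero_weights :: "'i set \<Rightarrow> ('i \<Rightarrow> 'a::zero) set \<Rightarrow> nat set" where
  "nonzero_weights X C = wt X ` C - {0}"

definition nkd_code :: "'i set \<Rightarrow> ('i \<Rightarrow> 'a::field) set \<Rightarrow> nat \<Rightarrow> nat \<Rightarrow> nat \<Rightarrow> bool" where
  "nkd_code X C N k d \<longleftrightarrow>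
     linear_code X C \<and> card X = N \<and> coord.dim C = k \<and> min_distance X C = d"

definition weight_code :: "nat \<Rightarrow> 'i set \<Rightarrow> ('i \<Rightarrow> 'a::field) set \<Rightarrow> bool" where
  "weight_code s X C \<longleftrightarrow> linear_code X C \<and> card (nonzero_weights X C) = s"

definition dot :: "nat \<Rightarrow> (nat \<Rightarrow> 'a::comm_ring_1) \<Rightarrow> (nat \<Rightarrow> 'a) \<Rightarrow> 'a" where
  "dot n u x = (\<Sum>i=1..n. u i * x i)"

definition codeword :: "nat \<Rightarrow> (nat \<Rightarrow> 'a::comm_ring_1) set \<Rightarrow> (nat \<Rightarrow> 'a) \<Rightarrow> ((nat \<Rightarrow> 'a) \<Rightarrow> 'a)" where
  "codeword n D u = (\<lambda>x. if x \<in> D then dot n u x else 0)"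

definition code_of :: "nat \<Rightarrow> (nat \<Rightarrow> 'a::comm_ring_1) set \<Rightarrow> ((nat \<Rightarrow> 'a) \<Rightarrow> 'a) set" where
  "code_of n D = codeword n D ` coord_space {1..n}"

text \<open>The strict order of the hierarchical poset on \<open>{1..n}\<close>.\<close>

definition hier_less :: "nat \<Rightarrow> nat \<Rightarrow> nat \<Rightarrow> nat \<Rightarrow> bool" where
  "hier_less m n i j \<longleftrightarrow> i \<in> {1..m} \<and> j \<in> {1..n} - {1..m}"

definition order_ideal :: "'i set \<Rightarrow> ('i \<Rightarrow> 'i \<Rightarrow> bool) \<Rightarrow> 'i set \<Rightarrow> bool" where
  "order_ideal P rel S \<longleftrightarrow> S \<subseteq> P \<and> (\<forall>j\<in>S. \<forall>i\<in>P. rel i j \<longrightarrow> i \<in> S)"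

definition full_mset :: "nat \<Rightarrow> nat \<Rightarrow> nat multiset" where
  "full_mset p n = (\<Sum>i\<in>{1..n}. replicate_mset (p - 1) i)"

definition unsat_ideal :: "nat \<Rightarrow> nat \<Rightarrow> nat \<Rightarrow> nat multiset \<Rightarrow> bool" where
  "unsat_ideal p m n J \<longleftrightarrow>
     J \<subseteq># full_mset p n \<and> order_ideal {1..n} (hier_less m n) (set_mset J)"

text \<open>
  The multiplicities of a sub-multiset lie in \<open>{0..p - 1}\<close>, so for \<open>p = CARD('p)\<close> it is determined
  by its multiplicity vector over \<open>'p mod_ring\<close>.
\<close>

definition mult_vec :: "nat multiset \<Rightarrow> (nat \<Rightarrow> 'p::prime_card mod_ring)" where
  "mult_vec J = (\<lambda>i. of_nat (count J i))"

definition unsat_ideals_in :: "nat \<Rightarrow> nat \<Rightarrow> nat \<Rightarrow> nat multiset \<Rightarrow> (nat \<Rightarrow> 'p::prime_card mod_ring) set" where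
  "unsat_ideals_in p m n I = mult_vec ` {J. unsat_ideal p m n J \<and> J \<subseteq># I}"

end

theory Submission
  imports Defs
begin

text \<open>
  Write \<open>q\<close> for the field size.  The vectors of the unsaturated generalized order ideals inside \<open>I\<close>
  are those supported on \<open>[m]\<close> together with those supported on \<open>[m] \<union> B\<close> that are nonzero on \<open>B\<close>
  and nonzero at every coordinate of \<open>[m]\<close>
  (\<open>unsat_ideals_in_eq\<close>).  Hence \<open>D\<close> is obtained from four coordinate boxes, that is, sets of
  vectors whose coordinates are restricted independently of each other: with \<open>F\<close> the field
  and \<open>F\<^sup>*\<close> its nonzero elements, the full space, minus the box with factors \<open>F\<close> on
  \<open>[m]\<close>, minus the box with factors \<open>F\<^sup>*\<close> on \<open>[m]\<close> and \<open>F\<close> on \<open>B\<close>, plus the box with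
  factors \<open>F\<^sup>*\<close> on \<open>[m]\<close>.  So every count over \<open>D\<close> is a signed sum of four counts over boxes
  (\<open>card_D_filter\<close>).

  The weight of a codeword counts the points of \<open>D\<close> where a linear form is nonzero.  On a box, the
  number of solutions of \<open>u \<cdot> x = c\<close> is governed by a product of one integer per coordinate, which
  is the exponential sum over that coordinate (\<open>card_box_linear_form\<close>); this is proved by induction
  on the number of coordinates, without using characters.  A factor \<open>F\<close> contributes \<open>q\<close> or \<open>0\<close>, a
  factor \<open>F\<^sup>*\<close> contributes \<open>q - 1\<close> or \<open>-1\<close>, according to whether the coordinate of \<open>u\<close> vanishes.
  The products over the four boxes give the weight formula (\<open>wt_codeword\<close>).

  The dimension is \<open>n\<close> because \<open>D\<close> contains enough vectors of the form \<open>e\<^sub>j\<close> and \<open>e\<^sub>j + e\<^sub>i\<close> to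
  force \<open>u = 0\<close> whenever the form \<open>u\<close> vanishes on \<open>D\<close> (\<open>kernel_trivial\<close>); only for \<open>m = 1\<close> and
  \<open>B = {2..n}\<close> this fails, and then \<open>D\<close> is the set of nonzero vectors supported on \<open>{2..n}\<close>.
\<close>

section \<open>Coordinate boxes and linear forms on them\<close>

text \<open>
  The vectors supported on \<open>X\<close> whose coordinate at each \<open>i \<in> X\<close> is taken from \<open>A i\<close>.
  Only the values \<open>A i\<close> with \<open>i \<in> X\<close> matter.
\<close>

definition box :: "'i set \<Rightarrow> ('i \<Rightarrow> 'a::zero set) \<Rightarrow> ('i \<Rightarrow> 'a) set" where
  "box X A = {f \<in> coord_space X. \<forall>i\<in>X. f i \<in> A i}"

lemma box_empty [simp]: "box {} A = {0}"
  by (auto simp: box_def coord_space_def fun_eq_iff)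

lemma box_UNIV: "box X (\<lambda>_. UNIV) = coord_space X"
  by (auto simp: box_def)

lemma bij_betw_box_insert:
  assumes "i \<notin> X"
  shows "bij_betw (\<lambda>(a, f). f(i := a)) (A i \<times> box X A) (box (insert i X) A)"
proof (rule bij_betw_byWitness[where f' = "\<lambda>f. (f i, f(i := 0))"])
  show "\<forall>z\<in>A i \<times> box X A. (\<lambda>f. (f i, f(i := 0))) (case z of (a, f) \<Rightarrow> f(i := a)) = z"
    using assms by (auto simp: box_def coord_space_def fun_eq_iff)
  show "(\<lambda>(a, f). f(i := a)) ` (A i \<times> box X A) \<subseteq> box (insert i X) A"
    using assms by (auto simp: box_def coord_space_def)
  show "(\<lambda>f. (f i, f(i := 0))) ` box (insert i X) A \<subseteq> A i \<times> box X A"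
    using assms by (auto simp: box_def coord_space_def)
qed auto

lemma finite_box:
  assumes "finite X" and "\<And>i. i \<in> X \<Longrightarrow> finite (A i)"
  shows "finite (box X A)"
  using assms
proof (induction X rule: finite_induct)
  case (insert i X)
  then show ?case
    using bij_betw_finite[OF bij_betw_box_insert[OF insert(2), of A]] by simp
qed simp

lemma card_box:
  assumes "finite X" and "\<And>i. i \<in> X \<Longrightarrow> finite (A i)"
  shows "card (box X A) = (\<Prod>i\<in>X. card (A i))"
  using assms
proof (induction X rule: finite_induct)
  case (insert i X)
  then show ?case
    using bij_betw_same_card[OF bij_betw_box_insert[OF insert(2), of A]]
    by (simp add: card_cartesian_product)
qed simp

lemma finite_coord_space:
  "finite X \<Longrightarrow> finite (coord_space X :: ('i \<Rightarrow> 'a::{zero,finite}) set)"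
  using finite_box[of X "\<lambda>_. UNIV :: 'a set"] by (simp add: box_UNIV)

lemma card_coord_space:
  "finite X \<Longrightarrow> card (coord_space X :: ('i \<Rightarrow> 'a::{zero,finite}) set) = CARD('a) ^ card X"
  using card_box[of X "\<lambda>_. UNIV :: 'a set"] by (simp add: box_UNIV)

text \<open>
  In terms of the nontrivial additive characters \<open>\<psi>\<close> of the field, the hypothesis on \<open>s i\<close> says that
  the sum of \<open>\<psi> (u i * a)\<close> over \<open>a \<in> A i\<close> equals \<open>s i\<close> for every \<open>\<psi>\<close>, and the lemma is the
  multiplicativity of these sums.  The factor \<open>q * of_bool (c = 0) - 1\<close> is the sum of all values
  \<open>\<psi> (- c)\<close>.
\<close>

lemma card_box_linear_form:
  fixes u :: "'i \<Rightarrow> 'a::{field,finite}" and s :: "'i \<Rightarrow> int"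
  assumes "finite X"
    and "\<And>i c. i \<in> X \<Longrightarrow> int CARD('a) * int (card {a \<in> A i. u i * a = c}) =
           int (card (A i)) + s i * (int CARD('a) * of_bool (c = 0) - 1)"
  shows "int CARD('a) * int (card {f \<in> box X A. (\<Sum>i\<in>X. u i * f i) = c}) =
           (\<Prod>i\<in>X. int (card (A i))) + (\<Prod>i\<in>X. s i) * (int CARD('a) * of_bool (c = 0) - 1)"
  using assms
proof (induction X arbitrary: c rule: finite_induct)
  case empty
  have "{f. f = (0 :: 'i \<Rightarrow> 'a) \<and> 0 = c} = (if c = 0 then {0} else {})" by auto
  then show ?case by simp
next
  case (insert i X)
  let ?q = "int CARD('a)"
  define N where "N d = {a \<in> A i. u i * a = d}" for d
  define M where "M d = {f \<in> box X A. (\<Sum>j\<in>X. u j * f j) = d}" for d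
  define P where "P = (\<Prod>j\<in>X. int (card (A j)))"
  define S where "S = (\<Prod>j\<in>X. s j)"
  have N: "?q * int (card (N d)) = int (card (A i)) + s i * (?q * of_bool (d = 0) - 1)" for d
    unfolding N_def by (rule insert.prems) simp
  have M: "?q * int (card (M d)) = P + S * (?q * of_bool (d = 0) - 1)" for d
    unfolding M_def P_def S_def using insert.IH[of d] insert.prems by simp
  have fin: "finite (N d)" "finite (M d)" for d
    using finite_box[of X A] insert.hyps by (auto simp: N_def M_def)
  have delta: "(\<Sum>d\<in>UNIV. of_bool (d = e) * r) = (r :: int)" for e :: 'a and r
    by (simp add: of_bool_def if_distrib[of "\<lambda>x. x * _"] cong: if_cong)
  have sum_upd: "(\<Sum>j\<in>X. u j * (f(i := a)) j) = (\<Sum>j\<in>X. u j * f j)" for f a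
    using insert.hyps by (intro sum.cong) auto
  \<comment> \<open>The solutions are sorted by the value \<open>d\<close> of the new term \<open>u i * a\<close>.\<close>
  have bij: "bij_betw (\<lambda>(a, f). f(i := a)) (\<Union>d. N d \<times> M (c - d))
               {f \<in> box (insert i X) A. (\<Sum>j\<in>insert i X. u j * f j) = c}"
    (is "bij_betw ?h ?L ?R")
  proof -
    let ?Z = "A i \<times> box X A"
    have inj: "inj_on ?h ?Z" and img: "?h ` ?Z = box (insert i X) A"
      using bij_betw_box_insert[OF insert.hyps(2), of A] by (auto simp: bij_betw_def)
    have L: "?L = {z \<in> ?Z. ?h z \<in> ?R}"
      using img insert.hyps sum_upd
      by (auto simp: N_def M_def algebra_simps simp del: fun_upd_apply) (auto)
    have "?R \<subseteq> ?h ` ?Z"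
      unfolding img by blast
    then have "?h ` {z \<in> ?Z. ?h z \<in> ?R} = ?R"
      by blast
    then show ?thesis
      using inj unfolding L bij_betw_def by (auto intro: inj_on_subset)
  qed
  have "card ?R = card ?L"
    using bij_betw_same_card[OF bij] by simp
  also have "\<dots> = (\<Sum>d\<in>UNIV. card (N d \<times> M (c - d)))"
    by (rule card_UN_disjoint) (use fin in \<open>auto simp: N_def\<close>)
  finally have "?q * (?q * int (card ?R)) =
      (\<Sum>d\<in>UNIV. (?q * int (card (N d))) * (?q * int (card (M (c - d)))))"
    by (simp add: card_cartesian_product sum_distrib_left algebra_simps)
  also have "\<dots> = (\<Sum>d\<in>UNIV. (int (card (A i)) - s i) * (P - S)
      + of_bool (d = 0) * (?q * s i * (P - S))
      + of_bool (d = c) * (?q * S * (int (card (A i)) - s i))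
      + of_bool (d = 0) * (of_bool (c = 0) * ?q * ?q * s i * S))"
    by (rule sum.cong) (auto simp: N M algebra_simps of_bool_def)
  also have "\<dots> = ?q * ((int (card (A i)) - s i) * (P - S) + s i * (P - S)
      + S * (int (card (A i)) - s i) + of_bool (c = 0) * ?q * s i * S)"
    unfolding sum.distrib delta by (simp add: algebra_simps)
  finally have "?q * int (card ?R) = (int (card (A i)) - s i) * (P - S) + s i * (P - S)
      + S * (int (card (A i)) - s i) + of_bool (c = 0) * ?q * s i * S"
    by (subst (asm) mult_cancel_left) auto
  then show ?case
    using insert.hyps by (simp add: P_def S_def algebra_simps)
qed

lemma card_linear_UNIV:
  fixes u :: "'a::{field,finite}"
  shows "int CARD('a) * int (card {a \<in> UNIV. u * a = c}) =
    int (card (UNIV :: 'a set)) + (int CARD('a) * of_bool (u = 0)) * (int CARD('a) * of_bool (c = 0) - 1)"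
proof (cases "u = 0")
  case False
  then have "{a \<in> UNIV. u * a = c} = {c / u}" by (auto simp: field_simps)
  then show ?thesis using False by simp
qed (auto simp: algebra_simps)

lemma card_nonzero_field: "int (card (- {0 :: 'a::{field,finite}})) = int CARD('a) - 1"
  by (simp add: Compl_eq_Diff_UNIV card_Diff_singleton of_nat_diff)

lemma card_linear_units:
  fixes u :: "'a::{field,finite}"
  shows "int CARD('a) * int (card {a \<in> - {0}. u * a = c}) =
    int (card (- {0 :: 'a})) + (int CARD('a) * of_bool (u = 0) - 1) * (int CARD('a) * of_bool (c = 0) - 1)"
proof (cases "u = 0")
  case True
  then have "{a \<in> - {0}. u * a = c} = (if c = 0 then - {0} else {})" by auto
  then show ?thesis using True by (simp add: card_nonzero_field algebra_simps)
next
  case False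
  then have "{a \<in> - {0}. u * a = c} = (if c = 0 then {} else {c / u})"
    by (auto simp: field_simps)
  then show ?thesis using False by (simp add: card_nonzero_field)
qed

lemma dot_coord_space:
  assumes "X \<subseteq> {1..n}" and "x \<in> coord_space X"
  shows "dot n u x = (\<Sum>i\<in>X. u i * x i)"
  unfolding dot_def
  by (rule sum.mono_neutral_right) (use assms in \<open>auto simp: coord_space_def\<close>)

lemma card_box_dot_nonzero:
  fixes u :: "nat \<Rightarrow> 'a::{field,finite}" and s :: "nat \<Rightarrow> int"
  assumes X: "X \<subseteq> {1..n}"
    and s: "\<And>i c. i \<in> X \<Longrightarrow> int CARD('a) * int (card {a \<in> A i. u i * a = c}) =
           int (card (A i)) + s i * (int CARD('a) * of_bool (c = 0) - 1)"
  shows "int CARD('a) * int (card {x \<in> box X A. dot n u x \<noteq> 0}) =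
           (int CARD('a) - 1) * ((\<Prod>i\<in>X. int (card (A i))) - (\<Prod>i\<in>X. s i))"
proof -
  have fin: "finite X" using X finite_subset by blast
  have finb: "finite (box X A)" by (rule finite_box[OF fin]) simp
  have dot: "dot n u x = (\<Sum>i\<in>X. u i * x i)" if "x \<in> box X A" for x
    using dot_coord_space[OF X] that by (auto simp: box_def)
  have "{x \<in> box X A. dot n u x \<noteq> 0} = box X A - {x \<in> box X A. (\<Sum>i\<in>X. u i * x i) = 0}"
    using dot by auto
  moreover have "card (box X A - {x \<in> box X A. (\<Sum>i\<in>X. u i * x i) = 0}) =
      card (box X A) - card {x \<in> box X A. (\<Sum>i\<in>X. u i * x i) = 0}"
    using finb by (intro card_Diff_subset) auto
  moreover have "card {x \<in> box X A. (\<Sum>i\<in>X. u i * x i) = 0} \<le> card (box X A)"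
    using finb by (intro card_mono) auto
  ultimately have nonzero: "int (card {x \<in> box X A. dot n u x \<noteq> 0}) =
      (\<Prod>i\<in>X. int (card (A i))) - int (card {x \<in> box X A. (\<Sum>i\<in>X. u i * x i) = 0})"
    using card_box[OF fin, of A] by (simp add: of_nat_diff)
  have zero: "int CARD('a) * int (card {x \<in> box X A. (\<Sum>i\<in>X. u i * x i) = 0}) =
      (\<Prod>i\<in>X. int (card (A i))) + (\<Prod>i\<in>X. s i) * (int CARD('a) - 1)"
    using card_box_linear_form[of X A u s 0, OF fin s] by simp
  show ?thesis
    unfolding nonzero right_diff_distrib zero by (simp add: algebra_simps)
qed

lemma prod_free_factor:
  "finite X \<Longrightarrow> (\<Prod>i\<in>X. q * of_bool (u i = 0)) = (q :: int) ^ card X * of_bool (\<forall>i\<in>X. u i = 0)"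
  by (induction X rule: finite_induct) auto

text \<open>
  The exponential sum over a box with nonzero coordinates; for \<open>card X = m\<close> and \<open>wt X u = k\<close> this is
  the number \<open>T\<^sub>k\<close>.
\<close>

lemma prod_units_factor:
  assumes "finite X"
  shows "(\<Prod>i\<in>X. q * of_bool (u i = 0) - 1) = (-1) ^ wt X u * (q - 1 :: int) ^ (card X - wt X u)"
proof -
  have "(\<Prod>i\<in>X. q * of_bool (u i = 0) - 1) = (\<Prod>i\<in>X. if u i = 0 then q - 1 else - 1)"
    by (rule prod.cong) auto
  also have "\<dots> = (q - 1) ^ card {i \<in> X. u i = 0} * (-1) ^ wt X u"
    using assms by (subst prod.If_cases) (auto simp: wt_def Int_def)
  also have "{i \<in> X. u i = 0} = X - {i \<in> X. u i \<noteq> 0}" by auto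
  also have "card \<dots> = card X - wt X u"
    unfolding wt_def using assms by (intro card_Diff_subset) auto
  finally show ?thesis by simp
qed

lemma card_coord_space_dot_nonzero:
  fixes u :: "nat \<Rightarrow> 'a::{field,finite}"
  assumes "X \<subseteq> {1..n}"
  shows "int CARD('a) * int (card {x \<in> coord_space X. dot n u x \<noteq> 0}) =
    (int CARD('a) - 1) * int CARD('a) ^ card X * of_bool (\<exists>i\<in>X. u i \<noteq> 0)"
proof -
  have "finite X" using assms finite_subset by blast
  then show ?thesis
    using card_box_dot_nonzero[OF assms, of "\<lambda>_. UNIV" u, OF card_linear_UNIV]
    by (auto simp: box_UNIV prod_free_factor)
qed

section \<open>Spanning vectors and linearity of the code\<close>

text \<open>
  The standard basis vector at position \<open>i\<close>, as a function on an arbitrary index type.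
\<close>

definition std_vec :: "'i \<Rightarrow> 'i \<Rightarrow> 'a::{zero,one}" where
  "std_vec i = (\<lambda>j. if j = i then 1 else 0)"

lemma dot_std_vec: "i \<in> {1..n} \<Longrightarrow> dot n u (std_vec i) = u i"
  by (simp add: dot_def std_vec_def if_distrib[of "\<lambda>x. _ * x"] sum.delta cong: if_cong)

lemma dot_add_right: "dot n u (x + y) = dot n u x + dot n u y"
  by (simp add: dot_def algebra_simps sum.distrib)

lemma dot_add_left: "dot n (u + v) x = dot n u x + dot n v x"
  by (simp add: dot_def algebra_simps sum.distrib)

lemma dot_scale_left: "dot n (coord_scale a u) x = a * dot n u x"
  by (simp add: dot_def coord_scale_def algebra_simps sum_distrib_left)

lemma subspace_coord_space: "coord.subspace (coord_space X)"
  by (auto simp: coord.subspace_def coord_space_def coord_scale_def)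

lemma inj_std_vec: "inj (std_vec :: 'i \<Rightarrow> 'i \<Rightarrow> 'a::zero_neq_one)"
  by (auto simp: inj_def std_vec_def fun_eq_iff split: if_splits)

lemma sum_std_vec:
  assumes "finite X"
  shows "(\<Sum>i\<in>X. coord_scale (a i) (std_vec i)) j = (if j \<in> X then a j else (0::'a::field))"
proof -
  have "(\<Sum>i\<in>X. coord_scale (a i) (std_vec i)) j = (\<Sum>i\<in>X. a i * std_vec i j)"
    using assms by (induction X rule: finite_induct) (auto simp: coord_scale_def)
  also have "\<dots> = (\<Sum>i\<in>X. if j = i then a i else 0)"
    by (rule sum.cong) (auto simp: std_vec_def)
  finally show ?thesis using assms by (simp add: sum.delta')
qed

lemma span_std_vec:
  assumes "finite X"
  shows "coord.span (std_vec ` X) = (coord_space X :: ('i \<Rightarrow> 'a::field) set)"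
proof
  show "coord.span (std_vec ` X) \<subseteq> (coord_space X :: ('i \<Rightarrow> 'a::field) set)"
    by (rule coord.span_minimal[OF _ subspace_coord_space]) (auto simp: coord_space_def std_vec_def)
next
  show "coord_space X \<subseteq> coord.span (std_vec ` X :: ('i \<Rightarrow> 'a::field) set)"
  proof
    fix u :: "'i \<Rightarrow> 'a" assume "u \<in> coord_space X"
    then have "u = (\<Sum>i\<in>X. coord_scale (u i) (std_vec i))"
      by (auto simp: fun_eq_iff sum_std_vec[OF assms] coord_space_def)
    moreover have "(\<Sum>i\<in>X. coord_scale (u i) (std_vec i)) \<in> coord.span (std_vec ` X)"
      by (intro coord.span_sum coord.span_scale coord.span_base) auto
    ultimately show "u \<in> coord.span (std_vec ` X)" by simp
  qed
qed

lemma independent_std_vec: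
  assumes "finite X"
  shows "coord.independent (std_vec ` X :: ('i \<Rightarrow> 'a::field) set)"
proof (rule coord.independent_if_scalars_zero)
  fix f :: "('i \<Rightarrow> 'a) \<Rightarrow> 'a" and x :: "'i \<Rightarrow> 'a"
  assume 0: "(\<Sum>x\<in>std_vec ` X. coord_scale (f x) x) = 0" and "x \<in> std_vec ` X"
  then obtain i where i: "i \<in> X" "x = std_vec i" by blast
  have "(\<Sum>j\<in>X. coord_scale (f (std_vec j)) (std_vec j)) = 0"
    using 0 by (subst (asm) sum.reindex) (auto intro: inj_on_subset[OF inj_std_vec])
  then show "f x = 0"
    using sum_std_vec[OF assms, of "\<lambda>j. f (std_vec j)" i] i by simp
qed (use assms in simp)

lemma linear_codeword: "Vector_Spaces.linear coord_scale coord_scale (codeword n D)"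
  by (auto simp: Vector_Spaces.linear_iff coord.vector_space_axioms codeword_def fun_eq_iff
      dot_add_left dot_scale_left) (auto simp: coord_scale_def dot_scale_left[unfolded coord_scale_def])

lemma linear_code_code_of:
  assumes "finite D"
  shows "linear_code D (code_of n D)"
proof -
  interpret Vector_Spaces.linear coord_scale coord_scale "codeword n D"
    by (rule linear_codeword)
  show ?thesis
    using assms subspace_image[OF subspace_coord_space, of "{1..n}"]
    by (auto simp: linear_code_def code_of_def codeword_def coord_space_def)
qed

text \<open>
  The coordinate set \<open>X\<close> may be smaller than \<open>{1..n}\<close>, so that the lemma also applies when
  \<open>codeword n D\<close> has a nonzero kernel on \<open>coord_space {1..n}\<close>, with \<open>coord_space X\<close> as a complement.
\<close>

lemma dim_code_of:
  fixes D :: "(nat \<Rightarrow> 'a::field) set"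
  assumes "finite X" and code: "code_of n D = codeword n D ` coord_space X"
    and ker: "\<And>u. u \<in> coord_space X \<Longrightarrow> codeword n D u = 0 \<Longrightarrow> u = 0"
  shows "coord.dim (code_of n D) = card X"
proof -
  interpret Vector_Spaces.linear coord_scale coord_scale "codeword n D"
    by (rule linear_codeword)
  have inj: "inj_on (codeword n D) (coord_space X)"
    using ker inj_on_iff_eq_0[OF subspace_coord_space] by blast
  have ind: "coord.independent (codeword n D ` std_vec ` X)"
    by (rule independent_injective_image)
      (use assms inj in \<open>auto simp: independent_std_vec span_std_vec\<close>)
  have span: "coord.span (codeword n D ` std_vec ` X) = codeword n D ` coord_space X"
    using span_image[of "std_vec ` X"] by (simp add: span_std_vec assms)
  have "coord.span (codeword n D ` coord_space X) = codeword n D ` coord_space X"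
    using subspace_image[OF subspace_coord_space] coord.span_eq_iff by blast
  then have "coord.dim (code_of n D) = card (codeword n D ` std_vec ` X)"
    unfolding code by (intro coord.dim_eq_card ind) (simp only: span)
  also have "\<dots> = card (std_vec ` X :: (nat \<Rightarrow> 'a) set)"
    by (rule card_image, rule inj_on_subset[OF inj]) (auto simp: coord_space_def std_vec_def)
  also have "\<dots> = card X"
    by (rule card_image) (rule inj_on_subset[OF inj_std_vec subset_UNIV])
  finally show ?thesis .
qed

lemma min_distance_one_weight:
  fixes C :: "('i \<Rightarrow> 'a::field) set"
  assumes C: "linear_code X C" and w: "nonzero_weights X C = {d}"
  shows "min_distance X C = d"
proof -
  have sub: "coord.subspace C" and fin: "finite X" and CX: "C \<subseteq> coord_space X"
    using C by (auto simp: linear_code_def)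
  have ham: "hamming_dist X f g = wt X (f - g)" for f g :: "'i \<Rightarrow> 'a"
    by (simp add: hamming_dist_def wt_def)
  have pos: "wt X f \<noteq> 0" if "f \<in> C" "f \<noteq> 0" for f
    using that fin CX by (auto simp: wt_def coord_space_def fun_eq_iff subset_iff)
  have "{hamming_dist X f g | f g. f \<in> C \<and> g \<in> C \<and> f \<noteq> g} = nonzero_weights X C"
  proof (intro equalityI subsetI)
    fix y assume "y \<in> {hamming_dist X f g | f g. f \<in> C \<and> g \<in> C \<and> f \<noteq> g}"
    then obtain f g where "f \<in> C" "g \<in> C" "f \<noteq> g" "y = wt X (f - g)" by (auto simp: ham)
    then show "y \<in> nonzero_weights X C"
      using coord.subspace_diff[OF sub, of f g] pos[of "f - g"] by (auto simp: nonzero_weights_def)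
  next
    fix y assume "y \<in> nonzero_weights X C"
    then obtain f where f: "f \<in> C" "y = wt X f" "y \<noteq> 0" by (auto simp: nonzero_weights_def)
    then have "f \<noteq> 0" by (auto simp: wt_def)
    then show "y \<in> {hamming_dist X f g | f g. f \<in> C \<and> g \<in> C \<and> f \<noteq> g}"
      using f coord.subspace_0[OF sub] ham[of f 0] by force
  qed
  then show ?thesis by (simp add: min_distance_def w)
qed

section \<open>Unsaturated order ideals as vectors\<close>

text \<open>
  The multiplicity vectors of the unsaturated order ideals supported on \<open>[m] \<union> B\<close>.  An ideal
  that meets \<open>B\<close> has to contain all of \<open>[m]\<close>.
\<close>

definition ideal_vectors :: "nat \<Rightarrow> nat set \<Rightarrow> (nat \<Rightarrow> 'a::zero) set" where
  "ideal_vectors m B = coord_space {1..m} \<union>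
     {x \<in> coord_space ({1..m} \<union> B). (\<forall>i\<in>{1..m}. x i \<noteq> 0) \<and> (\<exists>i\<in>B. x i \<noteq> 0)}"

lemma count_full_mset: "count (full_mset p n) i = (if i \<in> {1..n} then p - 1 else 0)"
  by (simp add: full_mset_def count_sum sum.delta')

lemma of_nat_mod_ring_eq_0_iff:
  assumes "c < CARD('p)"
  shows "(of_nat c :: 'p::prime_card mod_ring) = 0 \<longleftrightarrow> c = 0"
  using assms of_nat_0_mod_ring_dvd[where 'a = 'p, of c] by (metis gr_zeroI nat_dvd_not_less of_nat_0)

text \<open>
  Sub-multisets of \<open>I\<close> correspond to vectors supported on \<open>[m] \<union> B\<close>, since multiplicities below \<open>p\<close>
  are determined by their residues and vanish exactly when the residue does.
\<close>

lemma unsat_ideals_in_eq: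
  assumes p: "p = CARD('p::prime_card)" and "m < n" and B: "B \<subseteq> {1..n} - {1..m}"
    and I: "\<And>i. i \<in> {1..m} \<union> B \<Longrightarrow> count I i = p - 1" "\<And>i. i \<notin> {1..m} \<union> B \<Longrightarrow> count I i = 0"
  shows "unsat_ideals_in p m n I = (ideal_vectors m B :: (nat \<Rightarrow> 'p mod_ring) set)"
proof -
  let ?X = "{1..m} \<union> B"
  have finX: "finite ?X" using B finite_subset by auto
  have X: "?X \<subseteq> {1..n}" using assms by auto
  have p1: "p > 1" using p prime_card[where 'a = 'p] prime_gt_1_nat by blast
  have sub: "J \<subseteq># I \<longleftrightarrow> (\<forall>i. count J i < p) \<and> (\<forall>i. i \<notin> ?X \<longrightarrow> count J i = 0)" for J
  proof
    assume "J \<subseteq># I"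
    then have le: "count J i \<le> count I i" for i by (rule mset_subset_eq_count)
    have lt: "count I i < p" for i
      using I(1)[of i] I(2)[of i] p1 by (cases "i \<in> ?X") simp_all
    show "(\<forall>i. count J i < p) \<and> (\<forall>i. i \<notin> ?X \<longrightarrow> count J i = 0)"
    proof (intro conjI allI impI)
      show "count J i < p" for i using le[of i] lt[of i] by simp
      show "count J i = 0" if "i \<notin> ?X" for i using le[of i] I(2)[OF that] by simp
    qed
  next
    assume J: "(\<forall>i. count J i < p) \<and> (\<forall>i. i \<notin> ?X \<longrightarrow> count J i = 0)"
    show "J \<subseteq># I"
    proof (rule mset_subset_eqI)
      fix i
      have "count J i < p" "i \<notin> ?X \<Longrightarrow> count J i = 0" using J by blast+
      then show "count J i \<le> count I i"
        using I(1)[of i] by (cases "i \<in> ?X") simp_all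
    qed
  qed
  have full: "J \<subseteq># full_mset p n" if "J \<subseteq># I" for J
  proof (rule mset_subset_eqI)
    fix i
    have "count J i \<le> count I i" using that by (rule mset_subset_eq_count)
    then show "count J i \<le> count (full_mset p n) i"
      using I(1)[of i] I(2)[of i] X by (cases "i \<in> ?X") (auto simp: count_full_mset)
  qed
  have ideal: "order_ideal {1..n} (hier_less m n) (set_mset J) \<longleftrightarrow>
      (\<forall>i\<in>B. count J i = 0) \<or> (\<forall>i\<in>{1..m}. count J i \<noteq> 0)"
    if "J \<subseteq># I" for J
  proof -
    have "count J i = 0" if "i \<notin> ?X" for i using \<open>J \<subseteq># I\<close> that sub by blast
    then have "set_mset J \<subseteq> ?X" by (metis count_eq_zero_iff subsetI)
    then show ?thesis
      using B X unfolding order_ideal_def hier_less_def count_eq_zero_iff by blast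
  qed
  have vec: "mult_vec J \<in> (ideal_vectors m B :: (nat \<Rightarrow> 'p mod_ring) set) \<longleftrightarrow>
      (\<forall>i. i \<notin> ?X \<longrightarrow> count J i = 0) \<and> ((\<forall>i\<in>B. count J i = 0) \<or> (\<forall>i\<in>{1..m}. count J i \<noteq> 0))"
    if "\<forall>i. count J i < p" for J
  proof -
    have 0: "(mult_vec J :: nat \<Rightarrow> 'p mod_ring) i = 0 \<longleftrightarrow> count J i = 0" for i
      using that p by (simp add: mult_vec_def of_nat_mod_ring_eq_0_iff)
    show ?thesis
      using B unfolding ideal_vectors_def coord_space_def Un_iff mem_Collect_eq 0 by blast
  qed
  show ?thesis
  proof (intro equalityI subsetI)
    fix x :: "nat \<Rightarrow> 'p mod_ring" assume "x \<in> unsat_ideals_in p m n I"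
    then obtain J where "x = mult_vec J" "unsat_ideal p m n J" "J \<subseteq># I"
      by (auto simp: unsat_ideals_in_def)
    then show "x \<in> ideal_vectors m B"
      using vec[of J] sub[of J] ideal[of J] by (auto simp: unsat_ideal_def)
  next
    fix x :: "nat \<Rightarrow> 'p mod_ring" assume x: "x \<in> ideal_vectors m B"
    \<comment> \<open>The representative of \<open>x i\<close> in \<open>{0..p - 1}\<close> is the multiplicity of \<open>i\<close>.\<close>
    define a where "a i = (SOME c. c < CARD('p) \<and> x i = of_nat c)" for i
    have a: "a i < p" "x i = of_nat (a i)" for i
      using someI_ex[OF surj_of_nat_mod_ring[of "x i"]] unfolding a_def p by blast+
    define J where "J = (\<Sum>i\<in>?X. replicate_mset (a i) i)"
    have J: "count J i = (if i \<in> ?X then a i else 0)" for i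
      using finX by (simp add: J_def count_sum sum.delta')
    have supp: "x i = 0" if "i \<notin> ?X" for i
      using x that by (auto simp: ideal_vectors_def coord_space_def)
    have xJ: "x = mult_vec J"
    proof
      fix i show "x i = mult_vec J i"
        using supp[of i] a(2)[of i] by (auto simp: mult_vec_def J)
    qed
    have lt: "\<forall>i. count J i < p" using a p1 by (auto simp: J)
    then have JI: "J \<subseteq># I" using sub by (auto simp: J)
    have "unsat_ideal p m n J"
      using vec[OF lt] x ideal[OF JI] full[OF JI] unfolding xJ unsat_ideal_def by blast
    then show "x \<in> unsat_ideals_in p m n I"
      using xJ JI unfolding unsat_ideals_in_def by blast
  qed
qed

section \<open>Cardinality and weight formula\<close>

text \<open>
  The defining set \<open>D\<close> over an arbitrary finite field; primality of the field size is needed only to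
  identify sub-multisets with vectors.
\<close>

locale ideal_complement =
  fixes m n :: nat and B :: "nat set" and D :: "(nat \<Rightarrow> 'a::{field,finite}) set"
  assumes m: "1 \<le> m" "m < n"
    and B: "B \<subseteq> {1..n} - {1..m}" "B \<noteq> {}"
    and D: "D = coord_space {1..n} - ideal_vectors m B"
begin

lemma finite_B: "finite B" and card_B: "1 \<le> card B"
proof -
  show fin: "finite B" using B finite_subset by blast
  then show "1 \<le> card B" using B by (simp add: Suc_le_eq card_gt_0_iff)
qed

lemma finite_D: "finite D"
  unfolding D by (simp add: finite_coord_space)

lemma card_D_filter:
  "int (card {x \<in> D. Q x}) = int (card {x \<in> coord_space {1..n}. Q x})
     - int (card {x \<in> coord_space {1..m}. Q x})
     - int (card {x \<in> box ({1..m} \<union> B) (\<lambda>i. if i \<in> {1..m} then - {0} else UNIV). Q x})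
     + int (card {x \<in> box {1..m} (\<lambda>_. - {0}). Q x})"
proof -
  let ?full = "{x \<in> coord_space {1..n}. Q x} :: (nat \<Rightarrow> 'a) set"
  let ?E1 = "{x \<in> coord_space {1..m}. Q x} :: (nat \<Rightarrow> 'a) set"
  let ?E2 = "{x \<in> box ({1..m} \<union> B) (\<lambda>i. if i \<in> {1..m} then - {0} else UNIV). Q x} :: (nat \<Rightarrow> 'a) set"
  let ?E3 = "{x \<in> box {1..m} (\<lambda>_. - {0}). Q x} :: (nat \<Rightarrow> 'a) set"
  have fin: "finite ?full" "finite ?E1" "finite ?E2" "finite ?E3"
    using finite_B by (auto simp: finite_coord_space intro: finite_subset[OF _ finite_box])
  have disj: "B \<inter> {1..m} = {}" using B by auto
  have eq: "{x \<in> D. Q x} = ?full - (?E1 \<union> (?E2 - ?E3))"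
    unfolding D ideal_vectors_def box_def coord_space_def using disj by auto
  \<comment> \<open>A vector of the larger box lies in \<open>coord_space {1..m}\<close> exactly when it vanishes on \<open>B\<close>.\<close>
  have "?E2 \<inter> ?E1 \<subseteq> ?E3" and sub: "?E3 \<subseteq> ?E2"
    using disj by (auto simp: box_def coord_space_def)
  then have "card (?E1 \<union> (?E2 - ?E3)) = card ?E1 + (card ?E2 - card ?E3)"
    using fin by (subst card_Un_disjoint) (auto simp: card_Diff_subset)
  moreover have "card ?E3 \<le> card ?E2"
    using sub fin by (intro card_mono)
  moreover have "?E1 \<union> (?E2 - ?E3) \<subseteq> ?full"
  proof -
    have "{1..m} \<subseteq> {1..n}" "{1..m} \<union> B \<subseteq> {1..n}" using m B by auto
    then show ?thesis unfolding box_def coord_space_def by blast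
  qed
  then have "card {x \<in> D. Q x} = card ?full - card (?E1 \<union> (?E2 - ?E3))"
    "card (?E1 \<union> (?E2 - ?E3)) \<le> card ?full"
    unfolding eq using fin by (auto intro!: card_Diff_subset card_mono)
  ultimately show ?thesis by linarith
qed

lemma prod_split_B:
  "(\<Prod>i\<in>{1..m} \<union> B. if i \<in> {1..m} then f i else g i) = (\<Prod>i\<in>{1..m}. f i) * (\<Prod>i\<in>B. g i)"
  for f g :: "nat \<Rightarrow> int"
proof -
  have "(\<Prod>i\<in>{1..m} \<union> B. if i \<in> {1..m} then f i else g i) =
      (\<Prod>i\<in>{1..m}. if i \<in> {1..m} then f i else g i) * (\<Prod>i\<in>B. if i \<in> {1..m} then f i else g i)"
    using finite_B B by (intro prod.union_disjoint) auto
  also have "(\<Prod>i\<in>B. if i \<in> {1..m} then f i else g i) = (\<Prod>i\<in>B. g i)"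
    using B by (intro prod.cong) auto
  finally show ?thesis by simp
qed

lemma card_D: "int (card D) = int CARD('a) ^ n - int CARD('a) ^ m - (int CARD('a) - 1) ^ m * (int CARD('a) ^ card B - 1)"
proof -
  have "int (card (box ({1..m} \<union> B) (\<lambda>i. if i \<in> {1..m} then - {0} else UNIV) :: (nat \<Rightarrow> 'a) set)) =
      (\<Prod>i\<in>{1..m} \<union> B. if i \<in> {1..m} then int CARD('a) - 1 else int CARD('a))"
    using finite_B by (subst card_box) (auto simp: card_nonzero_field intro!: prod.cong)
  moreover have "int (card (box {1..m} (\<lambda>_. - {0}) :: (nat \<Rightarrow> 'a) set)) = (int CARD('a) - 1) ^ m"
    by (subst card_box) (auto simp: card_nonzero_field)
  ultimately show ?thesis
    using card_D_filter[of "\<lambda>_. True"] unfolding prod_split_B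
    by (simp add: card_coord_space algebra_simps)
qed

lemma wt_codeword:
  assumes "u \<in> coord_space {1..n}" "u \<noteq> 0"
  shows "int CARD('a) * int (wt D (codeword n D u)) = (int CARD('a) - 1) * (int (card D) + int CARD('a) ^ m * of_bool (wt {1..m} u = 0)
     + (-1) ^ wt {1..m} u * (int CARD('a) - 1) ^ (m - wt {1..m} u) * (int CARD('a) ^ card B * of_bool (\<forall>i\<in>B. u i = 0) - 1))"
proof -
  let ?T = "(-1) ^ wt {1..m} u * (int CARD('a) - 1) ^ (m - wt {1..m} u)"
  let ?\<delta> = "of_bool (\<forall>i\<in>B. u i = 0) :: int"
  let ?A = "\<lambda>i. if i \<in> {1..m} then - {0} else UNIV :: 'a set"
  let ?s = "\<lambda>i. if i \<in> {1..m} then int CARD('a) * of_bool (u i = 0) - 1 else int CARD('a) * of_bool (u i = 0)"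
  have "\<exists>i\<in>{1..n}. u i \<noteq> 0"
    using assms by (auto simp: coord_space_def fun_eq_iff) (metis atLeastAtMost_iff)
  then have full: "int CARD('a) * int (card {x \<in> coord_space {1..n}. dot n u x \<noteq> 0}) = (int CARD('a) - 1) * int CARD('a) ^ n"
    using card_coord_space_dot_nonzero[of "{1..n}" n u] by simp
  have E1: "int CARD('a) * int (card {x \<in> coord_space {1..m}. dot n u x \<noteq> 0}) =
      (int CARD('a) - 1) * (int CARD('a) ^ m - int CARD('a) ^ m * of_bool (wt {1..m} u = 0))"
    using card_coord_space_dot_nonzero[of "{1..m}" n u] m by (auto simp: wt_def)
  have card_A: "(\<Prod>i\<in>{1..m} \<union> B. int (card (?A i))) = (int CARD('a) - 1) ^ m * int CARD('a) ^ card B"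
  proof -
    have "(\<Prod>i\<in>{1..m} \<union> B. int (card (?A i))) = (\<Prod>i\<in>{1..m} \<union> B. if i \<in> {1..m} then int CARD('a) - 1 else int CARD('a))"
      by (intro prod.cong) (auto simp: card_nonzero_field)
    then show ?thesis unfolding prod_split_B by simp
  qed
  have prod_s: "(\<Prod>i\<in>{1..m} \<union> B. ?s i) = ?T * (int CARD('a) ^ card B * ?\<delta>)"
    unfolding prod_split_B using finite_B by (simp add: prod_units_factor prod_free_factor)
  have E2: "int CARD('a) * int (card {x \<in> box ({1..m} \<union> B) ?A. dot n u x \<noteq> 0}) =
      (int CARD('a) - 1) * ((int CARD('a) - 1) ^ m * int CARD('a) ^ card B - ?T * (int CARD('a) ^ card B * ?\<delta>))"
    unfolding card_A[symmetric] prod_s[symmetric]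
  proof (rule card_box_dot_nonzero)
    show "{1..m} \<union> B \<subseteq> {1..n}" using m B by auto
    show "int CARD('a) * int (card {a \<in> ?A i. u i * a = c}) = int (card (?A i)) + ?s i * (int CARD('a) * of_bool (c = 0) - 1)"
      for i c
      using card_linear_UNIV[of "u i" c] card_linear_units[of "u i" c] by (cases "i \<in> {1..m}") (simp_all only: if_True if_False)
  qed
  have E3: "int CARD('a) * int (card {x \<in> box {1..m} (\<lambda>_. - {0}). dot n u x \<noteq> 0}) = (int CARD('a) - 1) * ((int CARD('a) - 1) ^ m - ?T)"
    using card_box_dot_nonzero[of "{1..m}" n "\<lambda>_. - {0}" u, OF _ card_linear_units] m
    by (simp add: prod_units_factor card_nonzero_field)
  have "{x \<in> D. codeword n D u x \<noteq> 0} = {x \<in> D. dot n u x \<noteq> 0}"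
    by (auto simp: codeword_def)
  then have "int CARD('a) * int (wt D (codeword n D u)) = int CARD('a) * int (card {x \<in> D. dot n u x \<noteq> 0})"
    by (simp add: wt_def)
  also have "\<dots> = int CARD('a) * int (card {x \<in> coord_space {1..n}. dot n u x \<noteq> 0})
     - int CARD('a) * int (card {x \<in> coord_space {1..m}. dot n u x \<noteq> 0})
     - int CARD('a) * int (card {x \<in> box ({1..m} \<union> B) ?A. dot n u x \<noteq> 0})
     + int CARD('a) * int (card {x \<in> box {1..m} (\<lambda>_. - {0}). dot n u x \<noteq> 0})"
    by (simp only: card_D_filter[of "\<lambda>x. dot n u x \<noteq> 0"] right_diff_distrib distrib_left)
  finally show ?thesis
    unfolding full E1 E2 E3 card_D by (simp add: algebra_simps)
qed

end

section \<open>Triviality of the kernel\<close>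

context ideal_complement
begin

lemma mem_D_iff:
  "x \<in> D \<longleftrightarrow> x \<in> coord_space {1..n} \<and> (\<exists>i\<in>{1..n} - {1..m}. x i \<noteq> 0) \<and>
     ((\<exists>i\<in>{1..n} - {1..m} - B. x i \<noteq> 0) \<or> (\<exists>i\<in>{1..m}. x i = 0))"
proof (cases "x \<in> coord_space {1..n}")
  case True
  then have x: "x i = 0" if "i \<notin> {1..n}" for i using that by (auto simp: coord_space_def)
  have "x \<in> coord_space {1..m} \<longleftrightarrow> \<not> (\<exists>i\<in>{1..n} - {1..m}. x i \<noteq> 0)"
    using x unfolding coord_space_def by blast
  moreover have "x \<in> coord_space ({1..m} \<union> B) \<longleftrightarrow> \<not> (\<exists>i\<in>{1..n} - {1..m} - B. x i \<noteq> 0)"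
    using x unfolding coord_space_def by blast
  ultimately show ?thesis
    using True B unfolding D ideal_vectors_def by blast
qed (auto simp: D)

text \<open>
  If some \<open>j\<close> lies outside \<open>[m] \<union> B\<close>, every vector with nonzero coordinate \<open>j\<close> is in \<open>D\<close>.
  Otherwise \<open>m \<ge> 2\<close>, and a vector that is nonzero on \<open>B\<close> is in \<open>D\<close> as soon as one of its coordinates
  in \<open>[m]\<close> vanishes.
\<close>

lemma kernel_trivial:
  assumes ne: "(m, card B) \<noteq> (1, n - 1)" and u: "u \<in> coord_space {1..n}"
    and 0: "codeword n D u = 0"
  shows "u = 0"
proof -
  have dot0: "dot n u x = 0" if "x \<in> D" for x
    using fun_cong[OF 0, of x] that by (simp add: codeword_def)
  \<comment> \<open>Once \<open>x\<close> and \<open>x + std_vec i\<close> both lie in \<open>D\<close>, the coordinate \<open>u i\<close> vanishes.\<close>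
  have diff: "u i = 0" if "x \<in> D" "x + std_vec i \<in> D" "i \<in> {1..n}" for x i
    using dot0[OF that(1)] dot0[OF that(2)] dot_std_vec[OF that(3), of u] by (simp add: dot_add_right)
  have "u i = 0" if i: "i \<in> {1..n}" for i
  proof (cases "B = {1..n} - {1..m}")
    case False
    then obtain j where j: "j \<in> {1..n} - {1..m} - B" using B by blast
    have jD: "std_vec j \<in> D"
      unfolding mem_D_iff using j by (auto simp: coord_space_def std_vec_def)
    show ?thesis
    proof (cases "i = j")
      case True
      then show ?thesis using dot0[OF jD] dot_std_vec[OF i, of u] by simp
    next
      case False
      have "std_vec j + std_vec i \<in> D"
        unfolding mem_D_iff using j i False by (auto simp: coord_space_def std_vec_def)
      then show ?thesis using diff[OF jD] i by blast
    qed
  next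
    case True
    then have "card B = n - m" using m by (simp add: card_Diff_subset)
    then have m2: "2 \<le> m" using ne m by auto
    have unit: "std_vec j \<in> D" if "j \<in> B" for j
    proof -
      have "1 \<in> {1..m}" "std_vec j 1 = (0::'a)" "j \<in> {1..n} - {1..m}" "std_vec j j \<noteq> (0::'a)"
        using that B m by (auto simp: std_vec_def)
      moreover from this have "std_vec j \<in> (coord_space {1..n} :: (nat \<Rightarrow> 'a) set)"
        by (auto simp: coord_space_def std_vec_def)
      ultimately show ?thesis
        unfolding mem_D_iff by blast
    qed
    show ?thesis
    proof (cases "i \<in> B")
      case True
      then show ?thesis using dot0[OF unit] dot_std_vec[OF i, of u] by simp
    next
      case False
      then have im: "i \<in> {1..m}" using True i by auto
      obtain j where j: "j \<in> B" using B by blast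
      \<comment> \<open>A position of \<open>[m]\<close> where \<open>std_vec j + std_vec i\<close> vanishes; it exists because \<open>m \<ge> 2\<close>.\<close>
      define l where "l = (if i = 1 then 2 else 1::nat)"
      have l: "l \<in> {1..m}" "l \<noteq> i" using m2 by (auto simp: l_def)
      have jm: "j \<in> {1..n} - {1..m}" using j B by auto
      have "(std_vec j + std_vec i) l = (0::'a)" "(std_vec j + std_vec i) j \<noteq> (0::'a)"
        using l jm im by (auto simp: std_vec_def)
      moreover have "std_vec j + std_vec i \<in> (coord_space {1..n} :: (nat \<Rightarrow> 'a) set)"
        using jm i by (auto simp: coord_space_def std_vec_def)
      ultimately have "std_vec j + std_vec i \<in> D"
        unfolding mem_D_iff using l jm by blast
      then show ?thesis using diff[OF unit[OF j]] i by blast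
    qed
  qed
  then show ?thesis using u by (auto simp: coord_space_def fun_eq_iff)
qed

end

section \<open>Counting vectors by weight class\<close>

lemma card_weight_vectors:
  fixes X Y Z :: "'i set"
  assumes "finite Y" "X \<subseteq> Y" "Z \<subseteq> Y" "X \<inter> Z = {}"
  shows "card {u \<in> coord_space Y :: ('i \<Rightarrow> 'a::{zero,finite}) set. wt X u = j \<and> (\<forall>i\<in>Z. u i = 0)} =
    (card X choose j) * (CARD('a) - 1) ^ j * CARD('a) ^ (card Y - card X - card Z)"
proof -
  have finX: "finite X" using assms finite_subset by blast
  define A :: "'i set \<Rightarrow> 'i \<Rightarrow> 'a set"
    where "A S i = (if i \<in> S then - {0} else if i \<in> X \<union> Z then {0} else UNIV)" for S i
  let ?J = "{S. S \<subseteq> X \<and> card S = j}"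
  \<comment> \<open>The vectors in question with support \<open>S\<close> inside \<open>X\<close> form a box.\<close>
  have mem: "u \<in> box Y (A S) \<longleftrightarrow> u \<in> coord_space Y \<and> {i \<in> X. u i \<noteq> 0} = S \<and> (\<forall>i\<in>Z. u i = 0)"
    if "S \<subseteq> X" for u S
    using that assms by (auto simp: box_def A_def split: if_splits) blast
  have "{u \<in> coord_space Y. wt X u = j \<and> (\<forall>i\<in>Z. u i = 0)} = (\<Union>S\<in>?J. box Y (A S))"
    using mem by (auto simp: wt_def)
  also have "card \<dots> = (\<Sum>S\<in>?J. card (box Y (A S)))"
  proof (rule card_UN_disjoint)
    show "finite ?J" using finX by simp
    show "\<forall>S\<in>?J. finite (box Y (A S))" using assms by (auto intro: finite_box)
    have "box Y (A S) \<inter> box Y (A S') = {}" if "S \<subseteq> X" "S' \<subseteq> X" "S \<noteq> S'" for S S'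
      using mem[OF that(1)] mem[OF that(2)] that(3) by auto
    then show "\<forall>S\<in>?J. \<forall>S'\<in>?J. S \<noteq> S' \<longrightarrow> box Y (A S) \<inter> box Y (A S') = {}"
      by simp
  qed
  also have "\<dots> = (\<Sum>S\<in>?J. (CARD('a) - 1) ^ j * CARD('a) ^ (card Y - card X - card Z))"
  proof (rule sum.cong[OF refl])
    fix S assume S: "S \<in> ?J"
    have "card (box Y (A S)) = (\<Prod>i\<in>Y. card (A S i))"
      using assms by (intro card_box) auto
    also have "\<dots> = (\<Prod>i\<in>Y. (if i \<in> S then CARD('a) - 1 else 1) * (if i \<in> X \<union> Z then 1 else CARD('a)))"
      using S by (intro prod.cong) (auto simp: A_def Compl_eq_Diff_UNIV card_Diff_singleton)
    also have "\<dots> = (CARD('a) - 1) ^ card (Y \<inter> S) * CARD('a) ^ card (Y - (X \<union> Z))"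
    proof -
      have "Y \<inter> - {i. i \<in> X \<union> Z} = Y - (X \<union> Z)" by auto
      then show ?thesis using assms by (simp only: prod.distrib prod.If_cases) simp
    qed
    also have "Y \<inter> S = S" using S assms by auto
    also have "card (Y - (X \<union> Z)) = card Y - card X - card Z"
      using assms finite_subset[of _ Y] by (subst card_Diff_subset) (auto simp: card_Un_disjoint)
    finally show "card (box Y (A S)) = (CARD('a) - 1) ^ j * CARD('a) ^ (card Y - card X - card Z)"
      using S by simp
  qed
  also have "\<dots> = (card X choose j) * (CARD('a) - 1) ^ j * CARD('a) ^ (card Y - card X - card Z)"
    by (simp add: n_subsets[OF finX])
  finally show ?thesis .
qed

context ideal_complement
begin

lemma card_weight_class:
  shows "int (card {u \<in> coord_space {1..n} :: (nat \<Rightarrow> 'a) set. u \<noteq> 0 \<and> wt {1..m} u = j \<and> (\<forall>i\<in>B. u i = 0)}) =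
      int (m choose j) * (int CARD('a) - 1) ^ j * int (CARD('a) ^ (n - m - card B)) - of_bool (j = 0)" (is ?zero)
    and "int (card {u \<in> coord_space {1..n} :: (nat \<Rightarrow> 'a) set. u \<noteq> 0 \<and> wt {1..m} u = j \<and> \<not> (\<forall>i\<in>B. u i = 0)}) =
      int (m choose j) * (int CARD('a) - 1) ^ j * int (CARD('a) ^ (n - m) - CARD('a) ^ (n - m - card B))" (is ?nonzero)
proof -
  let ?V = "\<lambda>P. {u \<in> coord_space {1..n} :: (nat \<Rightarrow> 'a) set. P u}"
  let ?a = "(m choose j) * (CARD('a) - 1) ^ j"
  have fin: "finite (?V P)" for P
    by (rule finite_subset[OF _ finite_coord_space[of "{1..n}"]]) auto
  have wt0: "wt {1..m} (0 :: nat \<Rightarrow> 'a) = 0" by (simp add: wt_def)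
  have a: "int ?a = int (m choose j) * (int CARD('a) - 1) ^ j"
    by (simp add: of_nat_diff)
  have z: "card (?V (\<lambda>u. wt {1..m} u = j \<and> (\<forall>i\<in>B. u i = 0))) = ?a * CARD('a) ^ (n - m - card B)"
    using card_weight_vectors[where 'a = 'a, of "{1..n}" "{1..m}" B j] m B by auto
  have all: "card (?V (\<lambda>u. wt {1..m} u = j)) = ?a * CARD('a) ^ (n - m)"
    using card_weight_vectors[where 'a = 'a, of "{1..n}" "{1..m}" "{}" j] m by auto
  let ?Z = "?V (\<lambda>u. wt {1..m} u = j \<and> (\<forall>i\<in>B. u i = 0))"
  have finZ: "finite ?Z" by (rule fin)
  have "card (?V (\<lambda>u. u \<noteq> 0 \<and> wt {1..m} u = j \<and> (\<forall>i\<in>B. u i = 0))) = card (?Z - {0})"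
    by (rule arg_cong[of _ _ card]) auto
  moreover have "int (card (?Z - {0})) = int (card ?Z) - of_bool (j = 0)"
  proof (cases "j = 0")
    case True
    then have "0 \<in> ?Z" using wt0 by (simp add: coord_space_def)
    then show ?thesis
      using card_Suc_Diff1[OF finZ, of 0] True by simp
  next
    case False
    then have "0 \<notin> ?Z" using wt0 by simp
    then have "?Z - {0} = ?Z" by blast
    then show ?thesis using False by (simp only:) simp
  qed
  ultimately have "int (card (?V (\<lambda>u. u \<noteq> 0 \<and> wt {1..m} u = j \<and> (\<forall>i\<in>B. u i = 0)))) =
      int (card ?Z) - of_bool (j = 0)"
    by (simp only:)
  then show ?zero unfolding z of_nat_mult[of ?a] a by simp
  have "card (?V (\<lambda>u. u \<noteq> 0 \<and> wt {1..m} u = j \<and> \<not> (\<forall>i\<in>B. u i = 0))) =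
      card (?V (\<lambda>u. wt {1..m} u = j) - ?V (\<lambda>u. wt {1..m} u = j \<and> (\<forall>i\<in>B. u i = 0)))"
    by (rule arg_cong[of _ _ card]) auto
  also have "\<dots> = card (?V (\<lambda>u. wt {1..m} u = j)) - card (?V (\<lambda>u. wt {1..m} u = j \<and> (\<forall>i\<in>B. u i = 0)))"
    by (rule card_Diff_subset[OF fin]) blast
  also have "\<dots> = ?a * (CARD('a) ^ (n - m) - CARD('a) ^ (n - m - card B))"
    unfolding z all by (simp only: diff_mult_distrib2)
  finally show ?nonzero unfolding a[symmetric] of_nat_mult[symmetric] by (simp only:)
qed

lemma card_nonzero_weights: "card (nonzero_weights D (code_of n D)) \<le> 2 * (m + 1)"
proof -
  let ?g = "\<lambda>(j, d). nat ((int CARD('a) - 1) * (int (card D) + int CARD('a) ^ m * of_bool (j = 0)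
     + (-1) ^ j * (int CARD('a) - 1) ^ (m - j) * (int CARD('a) ^ card B * of_bool d - 1)) div int CARD('a))"
  let ?P = "{..m} \<times> (UNIV :: bool set)"
  have "nonzero_weights D (code_of n D) \<subseteq> ?g ` ?P"
  proof
    fix w assume "w \<in> nonzero_weights D (code_of n D)"
    then obtain u where u: "u \<in> coord_space {1..n}" "w = wt D (codeword n D u)" "w \<noteq> 0"
      by (auto simp: nonzero_weights_def code_of_def)
    have "codeword n D 0 = 0" by (auto simp: codeword_def dot_def)
    then have "u \<noteq> 0" using u by (auto simp: wt_def)
    then have "?g (wt {1..m} u, \<forall>i\<in>B. u i = 0) = w"
      using wt_codeword[OF u(1), symmetric] u(2) by simp
    moreover have "wt {1..m} u \<le> m"
      unfolding wt_def by (rule order_trans[OF card_mono[of "{1..m}"]]) auto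
    ultimately show "w \<in> ?g ` ?P" by (intro image_eqI[of _ _ "(wt {1..m} u, \<forall>i\<in>B. u i = 0)"]) auto
  qed
  then have "card (nonzero_weights D (code_of n D)) \<le> card (?g ` ?P)"
    by (intro card_mono) auto
  also have "\<dots> \<le> card ?P" by (rule card_image_le) simp
  also have "\<dots> = 2 * (m + 1)" by (simp add: card_cartesian_product)
  finally show ?thesis .
qed

end

section \<open>Three weights for one minimal element\<close>

context ideal_complement
begin

text \<open>
  For \<open>m = 1\<close> the classes with \<open>\<delta> = 0\<close> share one weight, which leaves three values.
\<close>

lemma wt_codeword_m1:
  assumes m1: "m = 1" and u: "u \<in> coord_space {1..n}" "u \<noteq> 0"
  shows "int (wt D (codeword n D u)) =
    (if \<exists>i\<in>B. u i \<noteq> 0 then (int CARD('a) - 1) * int CARD('a) ^ (n - 1) - (int CARD('a) - 1)\<^sup>2 * int CARD('a) ^ (card B - 1)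
     else if u 1 = 0 then (int CARD('a) - 1) * int CARD('a) ^ (n - 1)
     else (int CARD('a) - 1) * (int CARD('a) ^ (n - 1) - int CARD('a) ^ card B))" (is "_ = ?w")
proof -
  have b: "int CARD('a) ^ card B = int CARD('a) * int CARD('a) ^ (card B - 1)"
    using card_B by (cases "card B") auto
  have n: "int CARD('a) ^ n = int CARD('a) * int CARD('a) ^ (n - 1)"
    using m by (cases n) auto
  have "{i \<in> {1..1::nat}. u i \<noteq> 0} = (if u 1 = 0 then {} else {1})" by auto
  then have k: "wt {1..m} u = (if u 1 = 0 then 0 else 1)"
    by (simp add: wt_def m1)
  have "int CARD('a) * int (wt D (codeword n D u)) = int CARD('a) * ?w"
    unfolding wt_codeword[OF u] k card_D unfolding m1 b n by (auto simp: algebra_simps power2_eq_square)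
  then show ?thesis by (subst (asm) mult_cancel_left) auto
qed

lemma nonzero_weights_m1:
  assumes m1: "m = 1" and b: "card B \<le> n - 2"
  shows "int ` nonzero_weights D (code_of n D) =
     {(int CARD('a) - 1) * int CARD('a) ^ (n - 1) - (int CARD('a) - 1)\<^sup>2 * int CARD('a) ^ (card B - 1),
      (int CARD('a) - 1) * (int CARD('a) ^ (n - 1) - int CARD('a) ^ card B),
      (int CARD('a) - 1) * int CARD('a) ^ (n - 1)}" (is "_ = {?w1, ?w2, ?w3}")
    and "card (nonzero_weights D (code_of n D)) = 3"
proof -
  let ?q = "int CARD('a)"
  have q: "?q \<ge> 2"
    using card_mono[of UNIV "{0, 1 :: 'a}"] by simp
  have n2: "n \<ge> 2" using m by simp
  have Bb: "card B < n - 1" using b n2 by simp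
  have pow: "?q ^ card B < ?q ^ (n - 1)"
    using q Bb by (intro power_strict_increasing) auto
  have qb: "?q ^ card B = ?q * ?q ^ (card B - 1)"
    using card_B by (cases "card B") auto
  have pos: "0 < ?q ^ (card B - 1)" using q by simp
  have w2: "0 < ?w2" using q pow by simp
  have w1: "?w1 = ?w2 + (?q - 1) * ?q ^ (card B - 1)"
    unfolding qb by (simp add: algebra_simps power2_eq_square)
  have w3: "?w3 = ?w1 + (?q - 1)\<^sup>2 * ?q ^ (card B - 1)" by simp
  have lt: "?w2 < ?w1" "?w1 < ?w3"
  proof -
    have "0 < (?q - 1) * ?q ^ (card B - 1)" "0 < (?q - 1)\<^sup>2 * ?q ^ (card B - 1)"
      using q pos by (intro mult_pos_pos; simp)+
    then show "?w2 < ?w1" "?w1 < ?w3" using w1 w3 by linarith+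
  qed
  have zero: "wt D (codeword n D 0) = 0" by (simp add: wt_def codeword_def dot_def)
  have val: "int (wt D (codeword n D u)) \<in> {?w1, ?w2, ?w3}" if "u \<in> coord_space {1..n}" "u \<noteq> 0" for u
    unfolding wt_codeword_m1[OF m1 that] by simp
  have mem: "int (wt D (codeword n D u)) \<in> int ` nonzero_weights D (code_of n D)"
    if "u \<in> coord_space {1..n}" "u \<noteq> 0" for u
  proof -
    have "0 < int (wt D (codeword n D u))" using val[OF that] w2 lt by (elim insertE emptyE; linarith)
    then show ?thesis using that by (auto simp: nonzero_weights_def code_of_def)
  qed
  have unit: "std_vec i \<in> (coord_space {1..n} :: (nat \<Rightarrow> 'a) set)" "std_vec i \<noteq> (0 :: nat \<Rightarrow> 'a)"
    if "i \<in> {1..n}" for i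
    using that by (auto simp: coord_space_def std_vec_def fun_eq_iff)
  obtain i where i: "i \<in> B" using B by blast
  have "card (insert 1 B) < card {1..n}"
    using Bb finite_B by (auto simp: card_insert_if)
  then obtain j where j: "j \<in> {1..n}" "j \<notin> insert 1 B"
    using card_mono[of "insert 1 B" "{1..n}"] finite_B by fastforce
  have "1 \<notin> B" "i \<in> {1..n}" "1 \<in> {1..n}" using B i m m1 by auto
  note i1 = this
  \<comment> \<open>The three weights are attained at the standard basis vectors for \<open>i \<in> B\<close>, for \<open>1\<close>, and for \<open>j\<close> outside \<open>{1} \<union> B\<close>.\<close>
  have "\<exists>l\<in>B. std_vec i l \<noteq> (0::'a)" using i by (auto simp: std_vec_def)
  then have "int (wt D (codeword n D (std_vec i))) = ?w1"
    by (simp only: wt_codeword_m1[OF m1 unit[OF i1(2)]] if_True)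
  then have w1_mem: "?w1 \<in> int ` nonzero_weights D (code_of n D)"
    using mem[OF unit[OF i1(2)]] by (simp only:)
  have "\<not> (\<exists>l\<in>B. std_vec 1 l \<noteq> (0::'a))" "std_vec (1::nat) 1 = (1::'a)"
    using i1 by (auto simp: std_vec_def)
  then have "int (wt D (codeword n D (std_vec 1))) = ?w2"
    by (simp only: wt_codeword_m1[OF m1 unit[OF i1(3)]] if_False one_neq_zero)
  then have w2_mem: "?w2 \<in> int ` nonzero_weights D (code_of n D)"
    using mem[OF unit[OF i1(3)]] by (simp only:)
  have "\<not> (\<exists>l\<in>B. std_vec j l \<noteq> (0::'a))" "std_vec j 1 = (0::'a)"
    using j by (auto simp: std_vec_def)
  then have "int (wt D (codeword n D (std_vec j))) = ?w3"
    by (simp only: wt_codeword_m1[OF m1 unit[OF j(1)]] if_False if_True simp_thms)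
  then have w3_mem: "?w3 \<in> int ` nonzero_weights D (code_of n D)"
    using mem[OF unit[OF j(1)]] by (simp only:)
  have weights_sub: "int ` nonzero_weights D (code_of n D) \<subseteq> {?w1, ?w2, ?w3}"
  proof (rule image_subsetI)
    fix w assume "w \<in> nonzero_weights D (code_of n D)"
    then have "w \<in> wt D ` codeword n D ` coord_space {1..n}" "w \<noteq> 0"
      unfolding nonzero_weights_def code_of_def by blast+
    then obtain u where u: "u \<in> coord_space {1..n}" "w = wt D (codeword n D u)" "w \<noteq> 0"
      by blast
    have "u \<noteq> 0" using u(2,3) zero by metis
    then show "int w \<in> {?w1, ?w2, ?w3}" unfolding u(2) by (rule val[OF u(1)])
  qed
  show eq: "int ` nonzero_weights D (code_of n D) = {?w1, ?w2, ?w3}"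
  proof (rule equalityI[OF weights_sub])
    show "{?w1, ?w2, ?w3} \<subseteq> int ` nonzero_weights D (code_of n D)"
      by (intro insert_subsetI empty_subsetI w1_mem w2_mem w3_mem)
  qed
  have three: "card {a, b, c} = 3" if "b < a" "a < c" for a b c :: int
    using that by auto
  have "card (nonzero_weights D (code_of n D)) = card (int ` nonzero_weights D (code_of n D))"
    by (simp add: card_image)
  also have "\<dots> = 3"
    unfolding eq by (rule three[OF lt])
  finally show "card (nonzero_weights D (code_of n D)) = 3" .
qed

section \<open>The case of one minimal element and all other elements in the ideal\<close>

context
  assumes m1: "m = 1" and full: "card B = n - 1"
begin

lemma B_eq: "B = {2..n}"
proof -
  have sub: "B \<subseteq> {2..n}"
  proof
    fix i assume "i \<in> B"
    then have "i \<in> {1..n}" "i \<notin> {1..m}" using B by auto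
    then show "i \<in> {2..n}" by (simp add: m1)
  qed
  then show ?thesis
    by (rule card_subset_eq[rotated]) (simp_all add: full)
qed

lemma D_degenerate: "D = {x \<in> coord_space {1..n}. x 1 = 0 \<and> (\<exists>i\<in>{2..n}. x i \<noteq> 0)}"
proof -
  have sets: "{1..m} = {1}" "{1..n} - {1} = {2..n}" "{2..n} - B = {}"
    by (auto simp: m1 B_eq)
  show ?thesis
    by (rule Set.set_eqI) (simp only: mem_D_iff sets, auto)
qed

text \<open>
  All points of \<open>D\<close> have first coordinate \<open>0\<close>, so a codeword does not depend on \<open>u 1\<close>, and on the
  remaining coordinates the code is the one defined by all nonzero vectors.
\<close>

lemma D_degenerate_punctured: "D = coord_space {2..n} - {0}"
proof (intro equalityI subsetI)
  fix x assume "x \<in> D"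
  then have x: "\<And>i. i \<notin> {1..n} \<Longrightarrow> x i = 0" "x 1 = 0" "\<exists>i\<in>{2..n}. x i \<noteq> 0"
    by (auto simp: D_degenerate coord_space_def)
  have "x i = 0" if "i \<notin> {2..n}" for i
    using x(1)[of i] x(2) that by (cases "i = 1") auto
  then show "x \<in> coord_space {2..n} - {0}" using x(3) by (auto simp: coord_space_def)
next
  fix x :: "nat \<Rightarrow> 'a" assume "x \<in> coord_space {2..n} - {0}"
  then have x: "\<And>i. i \<notin> {2..n} \<Longrightarrow> x i = 0" and "x \<noteq> 0" by (auto simp: coord_space_def)
  then obtain i where "x i \<noteq> 0" by (auto simp: fun_eq_iff)
  then have "\<exists>i\<in>{2..n}. x i \<noteq> 0" using x by blast
  then show "x \<in> D" using x by (auto simp: D_degenerate coord_space_def)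
qed

lemma card_D_degenerate: "card D = CARD('a) ^ (n - 1) - 1"
proof -
  have "card D = card (coord_space {2..n} :: (nat \<Rightarrow> 'a) set) - 1"
    unfolding D_degenerate_punctured by (rule card_Diff_singleton) (simp add: coord_space_def)
  then show ?thesis by (simp add: card_coord_space)
qed

lemma wt_codeword_degenerate:
  "wt D (codeword n D u) = (CARD('a) - 1) * CARD('a) ^ (n - 2) * of_bool (\<exists>i\<in>{2..n}. u i \<noteq> 0)"
proof -
  have pow: "CARD('a) ^ (n - 1) = CARD('a) * CARD('a) ^ (n - 2)"
    using m m1 by (simp flip: power_Suc add: Suc_diff_Suc numeral_2_eq_2)
  have "dot n u 0 = 0" by (simp add: dot_def)
  then have "{x \<in> D. codeword n D u x \<noteq> 0} = {x \<in> coord_space {2..n}. dot n u x \<noteq> 0}"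
    unfolding codeword_def D_degenerate_punctured by auto
  then have "wt D (codeword n D u) = card {x \<in> coord_space {2..n}. dot n u x \<noteq> 0}"
    by (simp only: wt_def)
  moreover have "int CARD('a) * int (card {x \<in> coord_space {2..n}. dot n u x \<noteq> 0}) =
      int CARD('a) * int ((CARD('a) - 1) * CARD('a) ^ (n - 2) * of_bool (\<exists>i\<in>{2..n}. u i \<noteq> 0))"
  proof -
    have "{2..n} \<subseteq> {1..n}" by auto
    from card_coord_space_dot_nonzero[OF this, of u] show ?thesis
      using pow by (simp add: of_nat_diff flip: of_nat_power)
  qed
  ultimately have "CARD('a) * wt D (codeword n D u) =
      CARD('a) * ((CARD('a) - 1) * CARD('a) ^ (n - 2) * of_bool (\<exists>i\<in>{2..n}. u i \<noteq> 0))"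
    by (simp only: of_nat_mult[symmetric] of_nat_eq_iff)
  moreover have "0 < CARD('a)" by simp
  ultimately show ?thesis by (rule nat_mult_eq_cancel1[THEN iffD1, rotated])
qed

lemma codeword_degenerate_eq_0: "codeword n D u = 0 \<longleftrightarrow> (\<forall>i\<in>{2..n}. u i = 0)"
proof
  assume "codeword n D u = 0"
  then have "wt D (codeword n D u) = 0" by (simp add: wt_def)
  moreover have "CARD('a) \<ge> 2"
    using card_mono[of UNIV "{0, 1 :: 'a}"] by simp
  then have "(CARD('a) - 1) * CARD('a) ^ (n - 2) \<noteq> 0" by simp
  ultimately have "of_bool (\<exists>i\<in>{2..n}. u i \<noteq> 0) = (0::nat)"
    unfolding wt_codeword_degenerate by (simp only: mult_eq_0_iff simp_thms)
  then show "\<forall>i\<in>{2..n}. u i = 0"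
    by (simp only: of_bool_eq_0_iff) blast
next
  assume u: "\<forall>i\<in>{2..n}. u i = 0"
  have "dot n u x = 0" if "x \<in> D" for x
  proof -
    have "dot n u x = (\<Sum>i\<in>{2..n}. u i * x i)"
      using that unfolding D_degenerate_punctured by (intro dot_coord_space) auto
    then show ?thesis using u by simp
  qed
  then show "codeword n D u = 0" by (auto simp: codeword_def)
qed

lemma kernel_degenerate:
  "{u \<in> coord_space {1..n}. codeword n D u = 0} = range (\<lambda>a. coord_scale a (\<lambda>i. if i = 1 then 1 else 0))"
proof (intro equalityI subsetI)
  fix u assume "u \<in> {u \<in> coord_space {1..n}. codeword n D u = 0}"
  then have "u i = 0" if "i \<noteq> 1" for i
    using that by (cases "i \<in> {2..n}") (auto simp: codeword_degenerate_eq_0 coord_space_def)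
  then have "u = coord_scale (u 1) (\<lambda>i. if i = 1 then 1 else 0)"
    by (auto simp: coord_scale_def)
  then show "u \<in> range (\<lambda>a. coord_scale a (\<lambda>i. if i = 1 then 1 else 0))" by blast
next
  fix u :: "nat \<Rightarrow> 'a" assume "u \<in> range (\<lambda>a. coord_scale a (\<lambda>i. if i = 1 then 1 else 0))"
  then show "u \<in> {u \<in> coord_space {1..n}. codeword n D u = 0}"
    using m unfolding mem_Collect_eq codeword_degenerate_eq_0 by (auto simp: coord_scale_def coord_space_def)
qed

lemma dim_degenerate: "coord.dim (code_of n D) = n - 1"
proof -
  have "code_of n D = codeword n D ` coord_space {2..n}"
    unfolding code_of_def
  proof (intro equalityI subsetI)
    fix c assume "c \<in> codeword n D ` coord_space {1..n}"
    then obtain u where u: "u \<in> coord_space {1..n}" "c = codeword n D u" by blast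
    define v where "v = (\<lambda>i. if i \<in> {2..n} then u i else 0)"
    have "dot n u x = dot n v x" if "x \<in> D" for x
      using that dot_coord_space[of "{2..n}" n x] by (auto simp: D_degenerate_punctured v_def intro: sum.cong)
    then have "c = codeword n D v" using u by (auto simp: codeword_def)
    moreover have "v \<in> coord_space {2..n}" by (auto simp: v_def coord_space_def)
    ultimately show "c \<in> codeword n D ` coord_space {2..n}" by blast
  qed (auto simp: coord_space_def)
  then have "coord.dim (code_of n D) = card {2..n}"
  proof (rule dim_code_of[rotated])
    fix u assume u: "u \<in> coord_space {2..n}" "codeword n D u = 0"
    have "u i = 0" for i
      using u(1) u(2)[unfolded codeword_degenerate_eq_0] by (cases "i \<in> {2..n}") (auto simp: coord_space_def)
    then show "u = 0" by auto
  qed simp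
  then show ?thesis by simp
qed

lemma nonzero_weights_degenerate:
  "nonzero_weights D (code_of n D) = {(CARD('a) - 1) * CARD('a) ^ (n - 2)}"
proof -
  have q: "CARD('a) \<ge> 2"
    using card_mono[of UNIV "{0, 1 :: 'a}"] by simp
  have n: "2 \<in> {2..n}" "2 \<in> {1..n}" using m m1 by auto
  have "std_vec 2 \<in> (coord_space {1..n} :: (nat \<Rightarrow> 'a) set)"
    using n by (auto simp: coord_space_def std_vec_def)
  moreover have "wt D (codeword n D (std_vec 2)) = (CARD('a) - 1) * CARD('a) ^ (n - 2)"
    unfolding wt_codeword_degenerate using n by (auto simp: std_vec_def)
  ultimately have "(CARD('a) - 1) * CARD('a) ^ (n - 2) \<in> nonzero_weights D (code_of n D)"
    using q unfolding nonzero_weights_def code_of_def image_image by (intro DiffI) (rule image_eqI, auto)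
  moreover have "nonzero_weights D (code_of n D) \<subseteq> {(CARD('a) - 1) * CARD('a) ^ (n - 2)}"
    unfolding nonzero_weights_def code_of_def image_image wt_codeword_degenerate of_bool_def
    by (auto split: if_splits)
  ultimately show ?thesis by blast
qed

end

end

section \<open>The weight distribution\<close>

theorem theorem4p7:
  fixes p m n b :: nat and B :: "nat set" and I :: "nat multiset"
    and D :: "(nat \<Rightarrow> 'p::prime_card mod_ring) set"
    and k \<delta> :: "(nat \<Rightarrow> 'p mod_ring) \<Rightarrow> nat"
    and c :: "nat \<Rightarrow> nat" and T :: "nat \<Rightarrow> int"
  assumes "p = CARD('p)" and "prime p" and "odd p"
    and "1 \<le> m" and "m < n"
    and "B \<subseteq> {1..n} - {1..m}" and "card B = b" and "b \<ge> 1"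
    and "unsat_ideal p m n I"
    and "\<And>i. i \<in> {1..m} \<union> B \<Longrightarrow> count I i = p - 1"
    and "\<And>i. i \<notin> {1..m} \<union> B \<Longrightarrow> count I i = 0"
    and "D = coord_space {1..n} - unsat_ideals_in p m n I"
    and "\<And>u. k u = wt {1..m} u"
    and "\<And>u. \<delta> u = (if \<forall>i\<in>B. u i = 0 then 1 else 0)"
    and "c 1 = p ^ (n - m - b)"
    and "c 0 = p ^ (n - m) - p ^ (n - m - b)"
    and "\<And>j. T j = (-1) ^ j * (int p - 1) ^ (m - j)"
  shows
    "((m, b) \<noteq> (1, n - 1) \<longrightarrow>
        int (card D) = int p ^ n - int p ^ m - (int p - 1) ^ m * (int p ^ b - 1) \<and>
        linear_code D (code_of n D) \<and> coord.dim (code_of n D) = n \<and>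
        (\<forall>u \<in> coord_space {1..n}. u \<noteq> 0 \<longrightarrow>
           real (wt D (codeword n D u)) =
             (real p - 1) / real p *
             (real (card D) + real p ^ m * (if k u = 0 then 1 else 0)
               + real_of_int (T (k u)) * (real p ^ b * real (\<delta> u) - 1))) \<and>
        (\<forall>j \<le> m. \<forall>d \<in> {0, 1}.
           int (card {u \<in> coord_space {1..n}. u \<noteq> 0 \<and> k u = j \<and> \<delta> u = d}) =
             int (m choose j) * (int p - 1) ^ j * int (c d)
               - (if (j, d) = (0, 1) then 1 else 0)) \<and>
        card (nonzero_weights D (code_of n D)) \<le> 2 * (m + 1) \<and>
        (m = 1 \<and> b \<le> n - 2 \<longrightarrow>
           weight_code 3 D (code_of n D) \<and>
           int (card D) = int p ^ n - (int p - 1) * int p ^ b - 1 \<and>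
           int ` nonzero_weights D (code_of n D) =
             {(int p - 1) * int p ^ (n - 1) - (int p - 1)\<^sup>2 * int p ^ (b - 1),
              (int p - 1) * (int p ^ (n - 1) - int p ^ b),
              (int p - 1) * int p ^ (n - 1)}))
     \<and>
     ((m, b) = (1, n - 1) \<longrightarrow>
        D = {x \<in> coord_space {1..n}. x 1 = 0 \<and> (\<exists>i\<in>{2..n}. x i \<noteq> 0)} \<and>
        {u \<in> coord_space {1..n}. codeword n D u = 0} =
          range (\<lambda>a. coord_scale a (\<lambda>i. if i = 1 then 1 else 0)) \<and>
        weight_code 1 D (code_of n D) \<and>
        nkd_code D (code_of n D) (p ^ (n - 1) - 1) (n - 1) ((p - 1) * p ^ (n - 2)))"
proof -
  have p: "int p = int CARD('p mod_ring)" "p = CARD('p mod_ring)" and p0: "p > 0"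
    using assms(1,2) prime_gt_0_nat by auto
  have "unsat_ideals_in p m n I = (ideal_vectors m B :: (nat \<Rightarrow> 'p mod_ring) set)"
    by (rule unsat_ideals_in_eq) (use assms in auto)
  then interpret ideal_complement m n B D
    by unfold_locales (use assms in auto)
  have b: "b = card B" and k: "k = wt {1..m}" using assms by auto
  have lin: "linear_code D (code_of n D)" by (rule linear_code_code_of[OF finite_D])
  have weights: "\<forall>u \<in> coord_space {1..n}. u \<noteq> 0 \<longrightarrow>
      real (wt D (codeword n D u)) =
        (real p - 1) / real p *
        (real (card D) + real p ^ m * (if k u = 0 then 1 else 0)
          + real_of_int (T (k u)) * (real p ^ b * real (\<delta> u) - 1))"
    (is "\<forall>u\<in>_. _ \<longrightarrow> _ = _ * ?X u")
  proof (intro ballI impI)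
    fix u :: "nat \<Rightarrow> 'p mod_ring" assume u: "u \<in> coord_space {1..n}" "u \<noteq> 0"
    have \<delta>: "int (\<delta> u) = of_bool (\<forall>i\<in>B. u i = 0)" using assms(14) by simp
    have "int p * int (wt D (codeword n D u)) =
      (int p - 1) * (int (card D) + int p ^ m * of_bool (k u = 0) + T (k u) * (int p ^ b * int (\<delta> u) - 1))"
      unfolding p(1) k b \<delta> assms(17) by (rule wt_codeword[OF u])
    then have "real_of_int (int p * int (wt D (codeword n D u))) = real_of_int
      ((int p - 1) * (int (card D) + int p ^ m * of_bool (k u = 0) + T (k u) * (int p ^ b * int (\<delta> u) - 1)))"
      by (rule arg_cong)
    then have "real p * real (wt D (codeword n D u)) = (real p - 1) * ?X u"
      by (simp add: of_bool_def)
    then show "real (wt D (codeword n D u)) = (real p - 1) / real p * ?X u"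
      using p0 by (metis nonzero_mult_div_cancel_left of_nat_0_less_iff order_less_irrefl times_divide_eq_left)
  qed
  have count: "int (card {u \<in> coord_space {1..n}. u \<noteq> 0 \<and> k u = j \<and> \<delta> u = d}) =
      int (m choose j) * (int p - 1) ^ j * int (c d) - (if (j, d) = (0, 1) then 1 else 0)"
    if "j \<le> m" "d \<in> {0, 1}" for j d
  proof (cases "d = 1")
    case True
    have "\<delta> u = d \<longleftrightarrow> (\<forall>i\<in>B. u i = 0)" for u using True assms(14)[of u] by simp
    then show ?thesis
      using card_weight_class(1)[of j] assms(15) True unfolding p(2) k b by simp
  next
    case False
    then have "d = 0" using that by simp
    have "\<delta> u = d \<longleftrightarrow> \<not> (\<forall>i\<in>B. u i = 0)" for u using \<open>d = 0\<close> assms(14)[of u] by simp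
    then show ?thesis
      using card_weight_class(2)[of j] assms(16) \<open>d = 0\<close> unfolding p(2) k b by simp
  qed
  then have counts: "\<forall>j \<le> m. \<forall>d \<in> {0, 1}.
      int (card {u \<in> coord_space {1..n}. u \<noteq> 0 \<and> k u = j \<and> \<delta> u = d}) =
        int (m choose j) * (int p - 1) ^ j * int (c d) - (if (j, d) = (0, 1) then 1 else 0)"
    by blast
  have dim: "coord.dim (code_of n D) = n" if "(m, b) \<noteq> (1, n - 1)"
    using dim_code_of[of "{1..n}" n D] kernel_trivial that b by (simp add: code_of_def)
  have three_weight: "m = 1 \<and> b \<le> n - 2 \<longrightarrow>
      weight_code 3 D (code_of n D) \<and>
      int (card D) = int p ^ n - (int p - 1) * int p ^ b - 1 \<and>
      int ` nonzero_weights D (code_of n D) =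
        {(int p - 1) * int p ^ (n - 1) - (int p - 1)\<^sup>2 * int p ^ (b - 1),
         (int p - 1) * (int p ^ (n - 1) - int p ^ b),
         (int p - 1) * int p ^ (n - 1)}" (is "_ \<longrightarrow> ?three")
  proof (rule impI, elim conjE)
    assume m1: "m = 1" and bn: "b \<le> n - 2"
    have "int (card D) = int p ^ n - (int p - 1) * int p ^ b - 1"
      unfolding card_D p(1) b m1 by (simp add: algebra_simps)
    then show ?three
      using nonzero_weights_m1[OF m1 bn[unfolded b]] lin
      unfolding weight_code_def p(1) b by (intro conjI)
  qed
  have excluded: "D = {x \<in> coord_space {1..n}. x 1 = 0 \<and> (\<exists>i\<in>{2..n}. x i \<noteq> 0)} \<and>
      {u \<in> coord_space {1..n}. codeword n D u = 0} =
        range (\<lambda>a. coord_scale a (\<lambda>i. if i = 1 then 1 else 0)) \<and>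
      weight_code 1 D (code_of n D) \<and>
      nkd_code D (code_of n D) (p ^ (n - 1) - 1) (n - 1) ((p - 1) * p ^ (n - 2))"
    if "(m, b) = (1, n - 1)"
  proof -
    have *: "m = 1" "card B = n - 1" using that b by auto
    show ?thesis
      using D_degenerate[OF *] kernel_degenerate[OF *] lin nonzero_weights_degenerate[OF *] card_D_degenerate[OF *]
        dim_degenerate[OF *] min_distance_one_weight[OF lin nonzero_weights_degenerate[OF *]]
      unfolding weight_code_def nkd_code_def p(2) by (intro conjI) simp_all
  qed
  have card: "int (card D) = int p ^ n - int p ^ m - (int p - 1) ^ m * (int p ^ b - 1)"
    unfolding p(1) b by (rule card_D)
  let "(_ \<longrightarrow> ?generic) \<and> (_ \<longrightarrow> ?excluded)" = ?thesis
  show ?thesis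
  proof (rule conjI; rule impI)
    assume "(m, b) \<noteq> (1, n - 1)"
    then show ?generic
      by (intro conjI card lin dim weights counts card_nonzero_weights three_weight)
  next
    assume "(m, b) = (1, n - 1)"
    then show ?excluded by (rule excluded)
  qed
qed

end
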